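(* Let $\mu_1$ be a probability measure on $\mathbb{R}^{n_1}$ and $w_1:\mathbb{R}^{n_1}\to[0,\infty)$ a measurable function such that the couple $(\mu_1,w_1)$ satisfies Property $(\tau)$ on $\mathbb{R}^{n_1}$. Let $w_2:\mathbb{R}^{n_2}\to[0,\infty)$ be a measurable function and let $F:\mathbb{R}^{n_1}\to\mathbb{R}^{n_2}$ be a measurable mapping such that $$w_2(F(x)-F(y))\le w_1(x-y)\qquad\text{for all } x,y\in\mathbb{R}^{n_1}.$$ Let $\mu_2=F(\mu_1)$ be the image (push-forward) probability measure on $\mathbb{R}^{n_2}$. Then $(\mu_2,w_2)$ satisfies Property $(\tau)$ on $\mathbb{R}^{n_2}$.
   Context: Measures on $\mathbb{R}^n$ are Borel and "measurable" means Borel measurable; integrals are taken with respect to the completion of the measure (inf-convolutions of Borel functions are measurable for the completion). For functions $f,g$ on $\mathbb{R}^n$, the inf-convolution is $(f\,\square\, g)(x)=\inf\{f(x-y)+g(y): y\in\mathbb{R}^n\}$. Property $(\tau)$: if $\mu$ is a probability measure on $\mathbb{R}^n$ and $w\ge 0$ a measurable function on $\mathbb{R}^n$, the couple $(\mu,w)$ satisfies Property $(\tau)$ if for every bounded measurable function $\varphi:\mathbb{R}^n\to\mathbb{R}$, $$\Big(\int e^{\varphi\,\square\, w}\,d\mu\Big)\Big(\int e^{-\varphi}\,d\mu\Big)\le 1 .$$ *)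

theory Defs
  imports "HOL-Probability.Probability"
begin

text \<open>The infimum is taken in the reals. It is the true infimum whenever
  \<open>y \<mapsto> f (x - y) + g y\<close> is bounded below, in particular when \<open>f\<close> is bounded and
  \<open>g \<ge> 0\<close>.\<close>

definition inf_convolution ::
    "('a::euclidean_space \<Rightarrow> real) \<Rightarrow> ('a \<Rightarrow> real) \<Rightarrow> 'a \<Rightarrow> real" (infixl "\<box>" 70)
  where "(f \<box> g) x = (INF y. f (x - y) + g y)"

text \<open>Intended for a Borel probability measure \<open>\<mu>\<close> and a Borel function \<open>w \<ge> 0\<close>.
  Then \<open>\<phi> \<box> w\<close> is measurable for the completion of \<open>\<mu>\<close>, though not
  necessarily Borel, hence the use of \<^const>\<open>completion\<close>. The integrands are positive, so
  their integrals are taken in \<^typ>\<open>ennreal\<close>; both are finite, as the integrands are bounded.\<close>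

definition property_tau :: "'a::euclidean_space measure \<Rightarrow> ('a \<Rightarrow> real) \<Rightarrow> bool"
  where "property_tau \<mu> w \<longleftrightarrow>
    (\<forall>\<phi> :: 'a \<Rightarrow> real. \<phi> \<in> borel_measurable borel \<longrightarrow> bounded (range \<phi>) \<longrightarrow>
      (\<integral>\<^sup>+ x. ennreal (exp ((\<phi> \<box> w) x)) \<partial>completion \<mu>) *
      (\<integral>\<^sup>+ x. ennreal (exp (- \<phi> x)) \<partial>completion \<mu>) \<le> 1)"

end

theory Submission
  imports Defs
begin

text \<open>Replacing \<open>\<phi>\<close> by \<open>\<phi> \<circ> F\<close> in Property \<open>(\<tau>)\<close> for \<open>\<mu>\<^sub>1\<close> suffices: restricting the infimum defining
  \<open>(\<phi> \<box> w\<^sub>2) (F x)\<close> to the points \<open>F x - F z\<close> gives \<open>(\<phi> \<box> w\<^sub>2) \<circ> F \<le> (\<phi> \<circ> F) \<box> w\<^sub>1\<close>.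
  Measurability of the inf-convolutions is avoided: the library's integral is a supremum over
  simple minorants, and for such lower integrals one inequality of the change of variables
  holds for arbitrary functions.\<close>

text \<open>Any simple minorant \<open>s\<close> of \<open>f\<close> agrees almost everywhere with a
  function \<open>g\<close> measurable for \<open>N\<close>, and for \<open>g\<close> the change of
  variables is exact. The converse inequality is not to be expected for arbitrary \<open>f\<close>:
  a minorant of \<open>f \<circ> F\<close> need not factor through \<open>F\<close>.\<close>

lemma nn_integral_completion_distr_le:
  assumes F: "F \<in> measurable M N"
  shows "(\<integral>\<^sup>+ y. f y \<partial>completion (distr M N F)) \<le> (\<integral>\<^sup>+ x. f (F x) \<partial>completion M)"
  unfolding nn_integral_def[of "completion (distr M N F)" f]
proof (rule SUP_least, clarify)
  fix s :: "'b \<Rightarrow> ennreal"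
  assume s: "simple_function (completion (distr M N F)) s" "s \<le> f"
  from completion_ex_borel_measurable[OF borel_measurable_simple_function[OF s(1)]]
  obtain g where g: "g \<in> borel_measurable (distr M N F)"
    and sg: "AE y in distr M N F. s y = g y" by blast
  have "g \<in> borel_measurable N" using g by simp
  then have gF: "(\<lambda>x. g (F x)) \<in> borel_measurable M"
    using F by (rule measurable_compose[rotated])
  \<comment> \<open>Null sets of the image measure pull back along \<open>F\<close> to null sets of
    \<open>M\<close>.\<close>
  have "AE x in M. s (F x) = g (F x)"
    using AE_distrD[OF F sg] .
  then have ae: "AE x in completion M. g (F x) \<le> f (F x)"
    using s(2) by (intro AE_completion) (auto simp: le_fun_def elim!: eventually_mono, metis)
  have "integral\<^sup>S (completion (distr M N F)) s = (\<integral>\<^sup>+ y. s y \<partial>completion (distr M N F))"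
    using s(1) by (rule nn_integral_eq_simple_integral[symmetric])
  also have "\<dots> = (\<integral>\<^sup>+ y. g y \<partial>completion (distr M N F))"
    by (rule nn_integral_cong_AE, rule AE_completion[OF sg])
  also have "\<dots> = (\<integral>\<^sup>+ x. g (F x) \<partial>completion M)"
    using F g gF by (simp add: nn_integral_completion nn_integral_distr)
  \<comment> \<open>Monotonicity of the lower integral requires no measurability of
    \<open>f \<circ> F\<close>.\<close>
  also have "\<dots> \<le> (\<integral>\<^sup>+ x. f (F x) \<partial>completion M)"
    using ae by (rule nn_integral_mono_AE)
  finally show "integral\<^sup>S (completion (distr M N F)) s \<le> (\<integral>\<^sup>+ x. f (F x) \<partial>completion M)" .
qed

lemma inf_convolution_comp_le:
  assumes bdd: "bdd_below (range \<phi>)"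
    and nonneg: "\<And>y. 0 \<le> w\<^sub>2 y"
    and contr: "\<And>x y. w\<^sub>2 (F x - F y) \<le> w\<^sub>1 (x - y)"
  shows "(\<phi> \<box> w\<^sub>2) (F x) \<le> ((\<phi> \<circ> F) \<box> w\<^sub>1) x"
  unfolding inf_convolution_def
proof (rule cINF_mono)
  obtain m where m: "\<And>y. m \<le> \<phi> y" using bdd by (auto simp: bdd_below_def)
  \<comment> \<open>An infimum in the reals is a genuine lower bound only for a set bounded below;
    \<open>bdd\<close> and \<open>nonneg\<close> ensure this.\<close>
  show "bdd_below (range (\<lambda>y. \<phi> (F x - y) + w\<^sub>2 y))"
    by (rule bdd_belowI2[of _ m]) (use m nonneg in \<open>simp add: add_increasing2\<close>)
  fix y
  \<comment> \<open>With z = x - y, the witness F x - F z makes the argument of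
    \<open>\<phi>\<close> collapse to F z, and \<open>contr\<close> at x and z bounds the cost by
    \<open>w\<^sub>1 y\<close>.\<close>
  have "\<phi> (F x - (F x - F (x - y))) + w\<^sub>2 (F x - F (x - y)) \<le> (\<phi> \<circ> F) (x - y) + w\<^sub>1 y"
    using contr[of x "x - y"] by simp
  then show "\<exists>z\<in>UNIV. \<phi> (F x - z) + w\<^sub>2 z \<le> (\<phi> \<circ> F) (x - y) + w\<^sub>1 y" by blast
qed simp

theorem lemma3:
  fixes \<mu>\<^sub>1 :: "(real ^ 'n\<^sub>1) measure"
    and w\<^sub>1 :: "real ^ 'n\<^sub>1 \<Rightarrow> real"
    and w\<^sub>2 :: "real ^ 'n\<^sub>2 \<Rightarrow> real"
    and F :: "real ^ 'n\<^sub>1 \<Rightarrow> real ^ 'n\<^sub>2"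
  assumes "prob_space \<mu>\<^sub>1" and "sets \<mu>\<^sub>1 = sets borel"
    and "w\<^sub>1 \<in> borel_measurable borel" and "\<And>x. 0 \<le> w\<^sub>1 x"
    and "property_tau \<mu>\<^sub>1 w\<^sub>1"
    and "w\<^sub>2 \<in> borel_measurable borel" and "\<And>x. 0 \<le> w\<^sub>2 x"
    and "F \<in> borel_measurable borel"
    and "\<And>x y. w\<^sub>2 (F x - F y) \<le> w\<^sub>1 (x - y)"
  shows "property_tau (distr \<mu>\<^sub>1 borel F) w\<^sub>2"
  unfolding property_tau_def
proof (intro allI impI)
  fix \<phi> :: "real ^ 'n\<^sub>2 \<Rightarrow> real"
  assume \<phi>: "\<phi> \<in> borel_measurable borel" and bdd: "bounded (range \<phi>)"
  let ?\<nu> = "distr \<mu>\<^sub>1 borel F"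
  have F: "F \<in> measurable \<mu>\<^sub>1 borel"
    using assms(8) measurable_cong_sets[OF assms(2) refl] by blast
  have \<phi>F: "\<phi> \<circ> F \<in> borel_measurable borel"
    using assms(8) \<phi> by (rule measurable_comp)
  have "bounded (range (\<phi> \<circ> F))"
    using bdd by (rule bounded_subset) auto
  then have tau: "(\<integral>\<^sup>+ x. ennreal (exp (((\<phi> \<circ> F) \<box> w\<^sub>1) x)) \<partial>completion \<mu>\<^sub>1) *
      (\<integral>\<^sup>+ x. ennreal (exp (- (\<phi> \<circ> F) x)) \<partial>completion \<mu>\<^sub>1) \<le> 1"
    using assms(5) \<phi>F unfolding property_tau_def by blast
  have "(\<integral>\<^sup>+ y. ennreal (exp ((\<phi> \<box> w\<^sub>2) y)) \<partial>completion ?\<nu>)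
      \<le> (\<integral>\<^sup>+ x. ennreal (exp ((\<phi> \<box> w\<^sub>2) (F x))) \<partial>completion \<mu>\<^sub>1)"
    using F by (rule nn_integral_completion_distr_le)
  also have "\<dots> \<le> (\<integral>\<^sup>+ x. ennreal (exp (((\<phi> \<circ> F) \<box> w\<^sub>1) x)) \<partial>completion \<mu>\<^sub>1)"
    using inf_convolution_comp_le[where F = F and w\<^sub>2 = w\<^sub>2 and w\<^sub>1 = w\<^sub>1, OF bounded_imp_bdd_below[OF bdd] assms(7,9)]
    by (intro nn_integral_mono ennreal_leI) simp
  finally have conv: "(\<integral>\<^sup>+ y. ennreal (exp ((\<phi> \<box> w\<^sub>2) y)) \<partial>completion ?\<nu>)
      \<le> (\<integral>\<^sup>+ x. ennreal (exp (((\<phi> \<circ> F) \<box> w\<^sub>1) x)) \<partial>completion \<mu>\<^sub>1)" .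
  \<comment> \<open>Equality holds here since \<open>\<phi>\<close> is Borel, but an upper bound on
    each factor is enough for the product.\<close>
  have "(\<integral>\<^sup>+ y. ennreal (exp (- \<phi> y)) \<partial>completion ?\<nu>)
      \<le> (\<integral>\<^sup>+ x. ennreal (exp (- (\<phi> \<circ> F) x)) \<partial>completion \<mu>\<^sub>1)"
    using nn_integral_completion_distr_le[OF F, of "\<lambda>y. ennreal (exp (- \<phi> y))"] by simp
  with conv show "(\<integral>\<^sup>+ y. ennreal (exp ((\<phi> \<box> w\<^sub>2) y)) \<partial>completion ?\<nu>) *
      (\<integral>\<^sup>+ y. ennreal (exp (- \<phi> y)) \<partial>completion ?\<nu>) \<le> 1"
    by (rule order_trans[OF mult_mono tau]) simp_all
qed

end
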